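(* Let $n\ge 2$ and let $w_0^{(n)}=n(n-1)\cdots 21$ be the longest permutation of $\mathfrak S_n$. The map $\psi$ that replaces each entry $i$ of a filling by $\binom{n}{2}-i+1$ is an order-reversing involution on $\mathrm{SBT}(w_0^{(n)})$. In particular, $\mathrm{SBT}(w_0^{(n)})$ has a unique minimal element $B$, and $$\mathrm{inv}(B)=\frac{(n-2)(n-1)n(3n-5)}{24}.$$
   Context: The Rothe diagram of $w$ is $\mathbb D(w)=\{(i,w_j)\mid i<j,\ w_i>w_j\}$, the cell $(i,w_j)$ lying in row $i$ (rows numbered bottom to top) and column $w_j$; it has $\ell(w)$ cells, $\ell(w)$ being the number of pairs $i<j$ with $w_i>w_j$ (for $w_0^{(n)}$ this is $\binom n2$). $\mathrm{SBT}(w)$ is the set of bijective fillings of $\mathbb D(w)$ with $\{1,\ldots,\ell(w)\}$ such that for every cell, the number of cells to its right in the same row with larger entry equals the number of cells above it in the same column with smaller entry. Coxeter moves: $\mathfrak c_i$ exchanges entries $i$ and $i+1$ if they are neither in the same row nor in the same column, else is the identity; $\mathfrak b_i$ exchanges entries $i-1$ and $i+1$ if one of them lies in the same column as $i$ and above it and the other lies in the same row as $i$ and to its right, else is the identity. $\mathrm{inv}(R)$ is the number of pairs of entries $i<j$ with $i$ in a strictly higher row than $j$ and in a different column. The partial order on $\mathrm{SBT}(w)$ is the transitive closure of the covering relations $R>\mathfrak c_iR$ whenever $\mathrm{inv}(\mathfrak c_iR)=\mathrm{inv}(R)+1$ and $R>\mathfrak b_iR$ whenever $\mathrm{inv}(\mathfrak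 b_iR)=\mathrm{inv}(R)+1$. *)

theory Defs
  imports "HOL-Library.FuncSet" "HOL-Combinatorics.Transposition" Complex_Main
begin

text \<open>Permutations of \<open>{1..n}\<close> are functions \<^typ>\<open>nat \<Rightarrow> nat\<close> of which only the values on \<open>{1..n}\<close>
  are used. A cell is a pair (row, column); rows are numbered bottom to top, so ``above'' means
  larger row index.\<close>

definition longest_perm :: "nat \<Rightarrow> nat \<Rightarrow> nat" where
  "longest_perm n i = (if i \<in> {1..n} then n + 1 - i else i)"

definition perm_length :: "nat \<Rightarrow> (nat \<Rightarrow> nat) \<Rightarrow> nat" where
  "perm_length n w = card {(i, j). i \<in> {1..n} \<and> j \<in> {1..n} \<and> i < j \<and> w i > w j}"

definition rothe :: "nat \<Rightarrow> (nat \<Rightarrow> nat) \<Rightarrow> (nat \<times> nat) set" where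
  "rothe n w = {(i, w j) | i j. i \<in> {1..n} \<and> j \<in> {1..n} \<and> i < j \<and> w i > w j}"

text \<open>Fillings are \<^const>\<open>undefined\<close> outside the diagram, so that equality of functions is equality
  of fillings.\<close>

definition SBT :: "nat \<Rightarrow> (nat \<Rightarrow> nat) \<Rightarrow> (nat \<times> nat \<Rightarrow> nat) set" where
  "SBT n w = {R \<in> extensional (rothe n w).
     bij_betw R (rothe n w) {1..perm_length n w} \<and>
     (\<forall>(r, c) \<in> rothe n w.
        card {c'. (r, c') \<in> rothe n w \<and> c' > c \<and> R (r, c') > R (r, c)} =
        card {r'. (r', c) \<in> rothe n w \<and> r' > r \<and> R (r', c) < R (r, c)})}"

definition cell_of :: "nat \<Rightarrow> (nat \<Rightarrow> nat) \<Rightarrow> (nat \<times> nat \<Rightarrow> nat) \<Rightarrow> nat \<Rightarrow> nat \<times> nat" where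
  "cell_of n w R k = inv_into (rothe n w) R k"

abbreviation row_of :: "nat \<Rightarrow> (nat \<Rightarrow> nat) \<Rightarrow> (nat \<times> nat \<Rightarrow> nat) \<Rightarrow> nat \<Rightarrow> nat" where
  "row_of n w R k \<equiv> fst (cell_of n w R k)"

abbreviation col_of :: "nat \<Rightarrow> (nat \<Rightarrow> nat) \<Rightarrow> (nat \<times> nat \<Rightarrow> nat) \<Rightarrow> nat \<Rightarrow> nat" where
  "col_of n w R k \<equiv> snd (cell_of n w R k)"

definition exchange ::
  "nat \<Rightarrow> (nat \<Rightarrow> nat) \<Rightarrow> nat \<Rightarrow> nat \<Rightarrow> (nat \<times> nat \<Rightarrow> nat) \<Rightarrow> (nat \<times> nat \<Rightarrow> nat)" where
  "exchange n w a b R = restrict (\<lambda>x. transpose a b (R x)) (rothe n w)"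

definition move_c ::
  "nat \<Rightarrow> (nat \<Rightarrow> nat) \<Rightarrow> nat \<Rightarrow> (nat \<times> nat \<Rightarrow> nat) \<Rightarrow> (nat \<times> nat \<Rightarrow> nat)" where
  "move_c n w i R =
     (if row_of n w R i \<noteq> row_of n w R (i + 1) \<and> col_of n w R i \<noteq> col_of n w R (i + 1)
      then exchange n w i (i + 1) R else R)"

definition above_in_col :: "nat \<Rightarrow> (nat \<Rightarrow> nat) \<Rightarrow> (nat \<times> nat \<Rightarrow> nat) \<Rightarrow> nat \<Rightarrow> nat \<Rightarrow> bool" where
  "above_in_col n w R a b \<longleftrightarrow> col_of n w R a = col_of n w R b \<and> row_of n w R a > row_of n w R b"

definition right_in_row :: "nat \<Rightarrow> (nat \<Rightarrow> nat) \<Rightarrow> (nat \<times> nat \<Rightarrow> nat) \<Rightarrow> nat \<Rightarrow> nat \<Rightarrow> bool" where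
  "right_in_row n w R a b \<longleftrightarrow> row_of n w R a = row_of n w R b \<and> col_of n w R a > col_of n w R b"

definition move_b ::
  "nat \<Rightarrow> (nat \<Rightarrow> nat) \<Rightarrow> nat \<Rightarrow> (nat \<times> nat \<Rightarrow> nat) \<Rightarrow> (nat \<times> nat \<Rightarrow> nat)" where
  "move_b n w i R =
     (if above_in_col n w R (i - 1) i \<and> right_in_row n w R (i + 1) i \<or>
         above_in_col n w R (i + 1) i \<and> right_in_row n w R (i - 1) i
      then exchange n w (i - 1) (i + 1) R else R)"

definition sbt_inv :: "nat \<Rightarrow> (nat \<Rightarrow> nat) \<Rightarrow> (nat \<times> nat \<Rightarrow> nat) \<Rightarrow> nat" where
  "sbt_inv n w R = card {(i, j). i \<in> {1..perm_length n w} \<and> j \<in> {1..perm_length n w} \<and> i < j \<and>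
     row_of n w R i > row_of n w R j \<and> col_of n w R i \<noteq> col_of n w R j}"

text \<open>\<open>sbt_gt1 n w R S\<close> is the generating relation \<open>R > S\<close>. The ranges of \<open>i\<close> are those for which
  all entries involved in the move occur in the filling.\<close>

definition sbt_gt1 ::
  "nat \<Rightarrow> (nat \<Rightarrow> nat) \<Rightarrow> (nat \<times> nat \<Rightarrow> nat) \<Rightarrow> (nat \<times> nat \<Rightarrow> nat) \<Rightarrow> bool" where
  "sbt_gt1 n w R S \<longleftrightarrow> R \<in> SBT n w \<and> S \<in> SBT n w \<and> sbt_inv n w S = sbt_inv n w R + 1 \<and>
     ((\<exists>i. 1 \<le> i \<and> i + 1 \<le> perm_length n w \<and> S = move_c n w i R) \<or>
      (\<exists>i. 2 \<le> i \<and> i + 1 \<le> perm_length n w \<and> S = move_b n w i R))"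

definition sbt_less ::
  "nat \<Rightarrow> (nat \<Rightarrow> nat) \<Rightarrow> (nat \<times> nat \<Rightarrow> nat) \<Rightarrow> (nat \<times> nat \<Rightarrow> nat) \<Rightarrow> bool" where
  "sbt_less n w S R \<longleftrightarrow> (sbt_gt1 n w)\<^sup>+\<^sup>+ R S"

definition sbt_le ::
  "nat \<Rightarrow> (nat \<Rightarrow> nat) \<Rightarrow> (nat \<times> nat \<Rightarrow> nat) \<Rightarrow> (nat \<times> nat \<Rightarrow> nat) \<Rightarrow> bool" where
  "sbt_le n w S R \<longleftrightarrow> S \<in> SBT n w \<and> R \<in> SBT n w \<and> (S = R \<or> sbt_less n w S R)"

definition sbt_minimal :: "nat \<Rightarrow> (nat \<Rightarrow> nat) \<Rightarrow> (nat \<times> nat \<Rightarrow> nat) \<Rightarrow> bool" where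
  "sbt_minimal n w B \<longleftrightarrow> B \<in> SBT n w \<and> (\<forall>S \<in> SBT n w. \<not> sbt_less n w S B)"

definition psi :: "nat \<Rightarrow> (nat \<times> nat \<Rightarrow> nat) \<Rightarrow> (nat \<times> nat \<Rightarrow> nat)" where
  "psi n R = restrict (\<lambda>x. (n choose 2) - R x + 1) (rothe n (longest_perm n))"

end

theory Submission imports Defs begin

text \<open>The diagram is the staircase, and its cells \<open>(i, n + 1 - j)\<close> correspond to the inversions \<open>i < j\<close>.
  By induction on \<open>j - i\<close>, a filling is balanced iff for all \<open>i < k < j\<close> the entry of \<open>(i, j)\<close> lies
  between those of \<open>(i, k)\<close> and \<open>(k, j)\<close>, a condition stable under reversing all entries. Reversal
  complements the set of inversions of a filling, and hence reverses the order.

  The number of inversions is at most the number of pairs of cells in different rows and columns, and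
  the filling that reads rows from top to bottom, each from left to right, attains it. Any other
  filling is not minimal: at the first pair of consecutive entries \<open>m\<close>, \<open>m + 1\<close> at which the row
  goes up, either the two cells are in different columns and a commutation move applies, or they are
  \<open>(a, c)\<close> and \<open>(b, c)\<close>, and then betweenness forces \<open>m - 1\<close> into \<open>(a, b)\<close>, so that a braid
  move applies.\<close>

section \<open>Balance and betweenness\<close>

text \<open>The intermediate indices \<open>k\<close> pair up the row part and the column part of
  the hook of \<open>(i, j)\<close>. Balance only equates the sizes of the sets \<open>L\<close> and
  \<open>M\<close> of indices at which the row entry is larger, respectively the column entry
  smaller; the induction upgrades this to \<open>L = M\<close>, which is betweenness once ties are
  excluded.\<close>

lemma balanced_imp_between:
  fixes T :: "nat \<Rightarrow> nat \<Rightarrow> nat"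
  assumes bal: "\<And>i j. 1 \<le> i \<Longrightarrow> i < j \<Longrightarrow> j \<le> n \<Longrightarrow>
      card {k. i < k \<and> k < j \<and> T i k > T i j} = card {k. i < k \<and> k < j \<and> T k j < T i j}"
    and dist: "\<And>i k j. 1 \<le> i \<Longrightarrow> i < k \<Longrightarrow> k < j \<Longrightarrow> j \<le> n \<Longrightarrow> T i k \<noteq> T i j \<and> T k j \<noteq> T i j"
  shows "1 \<le> i \<Longrightarrow> i < k \<Longrightarrow> k < j \<Longrightarrow> j \<le> n \<Longrightarrow>
      (T i k < T i j \<and> T i j < T k j) \<or> (T k j < T i j \<and> T i j < T i k)"
proof (induction "j - i" arbitrary: i k j rule: less_induct)
  case less
  have IH: "(T i' k' < T i' j' \<and> T i' j' < T k' j') \<or> (T k' j' < T i' j' \<and> T i' j' < T i' k')"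
    if "i \<le> i'" "i' < k'" "k' < j'" "j' \<le> j" "i < i' \<or> j' < j" for i' k' j'
    by (rule less.hyps) (use that less.prems in auto)
  define L where "L = {k. i < k \<and> k < j \<and> T i k > T i j}"
  define M where "M = {k. i < k \<and> k < j \<and> T k j < T i j}"
  have fin: "finite L" "finite M" unfolding L_def M_def by auto
  have card: "card L = card M"
    unfolding L_def M_def by (rule bal) (use less.prems in auto)
  have ij: "T i k' \<noteq> T i j" "T k' j \<noteq> T i j" if "i < k'" "k' < j" for k'
    using dist[of i k' j] that less.prems by auto
  have "L = M"
  proof (rule ccontr)
    assume "L \<noteq> M"
    then have "\<not> L \<subseteq> M" "\<not> M \<subseteq> L"
      using card_subset_eq[OF fin(2) _ card] card_subset_eq[OF fin(1) _ card[symmetric]] by auto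
    then obtain p q where p: "p \<in> L" "p \<notin> M" and q: "q \<in> M" "q \<notin> L" by auto
    have p': "i < p" "p < j" "T i p > T i j" "T p j > T i j"
      using p ij[of p] unfolding L_def M_def by auto
    have q': "i < q" "q < j" "T i q < T i j" "T q j < T i j"
      using q ij[of q] unfolding L_def M_def by auto
    \<comment> \<open>Both entries at \<open>p\<close> exceed \<open>T i j\<close> and both at
      \<open>q\<close> lie below it. Whichever index comes first, the two shorter triples force the
      entry of the pair formed by \<open>p\<close> and \<open>q\<close> to be both above and below
      \<open>T i j\<close>.\<close>
    consider "p < q" | "q < p" using p q by fastforce
    then show False
    proof cases
      case 1
      show False using IH[of i p q] IH[of p q j] p' q' 1 by auto
    next
      case 2
      show False using IH[of i q p] IH[of q p j] p' q' 2 by auto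
    qed
  qed
  then have "k \<in> L \<longleftrightarrow> k \<in> M" by simp
  then show ?case using ij[of k] less.prems unfolding L_def M_def by auto
qed

section \<open>The staircase diagram and its balanced fillings\<close>

definition staircase :: "nat \<Rightarrow> (nat \<times> nat) set" where
  "staircase n = {(r, c). 1 \<le> r \<and> 1 \<le> c \<and> r + c \<le> n}"

lemma rothe_longest_perm: "rothe n (longest_perm n) = staircase n"
proof (intro set_eqI iffI)
  fix x assume "x \<in> rothe n (longest_perm n)"
  then show "x \<in> staircase n"
    by (auto simp: rothe_def staircase_def longest_perm_def)
next
  fix x assume x: "x \<in> staircase n"
  obtain r c where rc: "x = (r, c)" by force
  have "x = (r, longest_perm n (n + 1 - c)) \<and> r \<in> {1..n} \<and> n + 1 - c \<in> {1..n} \<and> r < n + 1 - c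
      \<and> longest_perm n r > longest_perm n (n + 1 - c)"
    using x unfolding rc by (auto simp: staircase_def longest_perm_def)
  then show "x \<in> rothe n (longest_perm n)" unfolding rothe_def by blast
qed

lemma finite_staircase: "finite (staircase n)"
  by (rule finite_subset[of _ "{1..n} \<times> {1..n}"]) (auto simp: staircase_def)

lemma card_staircase: "card (staircase n) = n choose 2"
proof -
  have "staircase n = Sigma {1..n} (\<lambda>r. {1..n - r})"
    by (auto simp: staircase_def)
  then have "card (staircase n) = (\<Sum>r = 1..n. n - r)" by simp
  also have "\<dots> = (\<Sum>r = 0..<n. r)"
    by (rule sum.reindex_bij_witness[of _ "\<lambda>r. n - r" "\<lambda>r. n - r"]) auto
  also have "\<dots> = n choose 2"
    by (induction n) (auto simp: numeral_2_eq_2)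
  finally show ?thesis .
qed

lemma perm_length_longest_perm: "perm_length n (longest_perm n) = n choose 2"
proof -
  have "perm_length n (longest_perm n) = card (staircase n)"
    unfolding perm_length_def
    by (rule bij_betw_same_card[of "\<lambda>(i, j). (i, n + 1 - j)"],
        rule bij_betw_byWitness[of _ "\<lambda>(i, j). (i, n + 1 - j)"])
       (auto simp: staircase_def longest_perm_def)
  then show ?thesis by (simp add: card_staircase)
qed

text \<open>If the cell \<open>(i, n + 1 - j)\<close> is read as the positive root
  \<open>e_i - e_j\<close>, this is the convexity condition of a reflection order of type A: the sum
  of two roots comes between them.\<close>

definition betweenness :: "nat \<Rightarrow> (nat \<times> nat \<Rightarrow> nat) \<Rightarrow> bool" where
  "betweenness n R \<longleftrightarrow> (\<forall>i k j. 1 \<le> i \<and> i < k \<and> k < j \<and> j \<le> n \<longrightarrow>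
     R (i, n + 1 - k) < R (i, n + 1 - j) \<and> R (i, n + 1 - j) < R (k, n + 1 - j) \<or>
     R (k, n + 1 - j) < R (i, n + 1 - j) \<and> R (i, n + 1 - j) < R (i, n + 1 - k))"

lemma betweennessD:
  assumes "betweenness n R" "1 \<le> i" "i < k" "k < j" "j \<le> n"
  shows "R (i, n + 1 - k) < R (i, n + 1 - j) \<and> R (i, n + 1 - j) < R (k, n + 1 - j) \<or>
     R (k, n + 1 - j) < R (i, n + 1 - j) \<and> R (i, n + 1 - j) < R (i, n + 1 - k)"
  using assms unfolding betweenness_def by blast

text \<open>Since row \<open>i\<close> ends at column \<open>n - i\<close>, the reflection
  \<open>k\<close> to \<open>n + 1 - k\<close> identifies the cells to the right of
  \<open>(i, n + 1 - j)\<close> with the indices strictly between \<open>i\<close> and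
  \<open>j\<close>; the cells above are indexed by the same \<open>k\<close>.\<close>

lemma SBT_longest_perm_iff:
  "R \<in> SBT n (longest_perm n) \<longleftrightarrow> R \<in> extensional (staircase n) \<and>
     bij_betw R (staircase n) {1..n choose 2} \<and> betweenness n R"
proof -
  define T where "T i j = R (i, n + 1 - j)" for i j
  let ?bal = "\<lambda>r c. card {c'. (r, c') \<in> staircase n \<and> c' > c \<and> R (r, c') > R (r, c)} =
        card {r'. (r', c) \<in> staircase n \<and> r' > r \<and> R (r', c) < R (r, c)}"
  have bal_iff: "?bal i (n + 1 - j) \<longleftrightarrow>
      card {k. i < k \<and> k < j \<and> T i k > T i j} = card {k. i < k \<and> k < j \<and> T k j < T i j}"
    if "1 \<le> i" "i < j" "j \<le> n" for i j
  proof -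
    have "card {c'. (i, c') \<in> staircase n \<and> c' > n + 1 - j \<and> R (i, c') > R (i, n + 1 - j)}
        = card {k. i < k \<and> k < j \<and> T i k > T i j}"
      by (rule bij_betw_same_card[of "\<lambda>k. n + 1 - k"],
          rule bij_betw_byWitness[of _ "\<lambda>k. n + 1 - k"])
         (use that in \<open>auto simp: staircase_def T_def Suc_diff_le\<close>)
    moreover have "{r'. (r', n + 1 - j) \<in> staircase n \<and> r' > i \<and> R (r', n + 1 - j) < R (i, n + 1 - j)}
        = {k. i < k \<and> k < j \<and> T k j < T i j}"
      using that by (auto simp: staircase_def T_def)
    ultimately show ?thesis by simp
  qed
  have "(\<forall>(r, c) \<in> staircase n. ?bal r c) \<longleftrightarrow> betweenness n R"
    if bij: "bij_betw R (staircase n) {1..n choose 2}"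
  proof
    assume bal: "\<forall>(r, c) \<in> staircase n. ?bal r c"
    have balT: "card {k. i < k \<and> k < j \<and> T i k > T i j} = card {k. i < k \<and> k < j \<and> T k j < T i j}"
      if "1 \<le> i" "i < j" "j \<le> n" for i j
    proof -
      have "(i, n + 1 - j) \<in> staircase n" using that by (auto simp: staircase_def)
      then show ?thesis using bal bal_iff[OF that] by blast
    qed
    have inj: "inj_on R (staircase n)" using bij by (rule bij_betw_imp_inj_on)
    have dist: "T i k \<noteq> T i j \<and> T k j \<noteq> T i j" if "1 \<le> i" "i < k" "k < j" "j \<le> n" for i k j
    proof -
      have "(i, n + 1 - j) \<in> staircase n" "(k, n + 1 - j) \<in> staircase n" "(i, n + 1 - k) \<in> staircase n"
        using that by (auto simp: staircase_def)
      then show ?thesis unfolding T_def using inj_on_eq_iff[OF inj] that by auto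
    qed
    show "betweenness n R"
      unfolding betweenness_def using balanced_imp_between[of n T, OF balT dist]
      unfolding T_def by blast
  next
    assume btw: "betweenness n R"
    show "\<forall>(r, c) \<in> staircase n. ?bal r c"
    proof clarify
      fix r c assume rc: "(r, c) \<in> staircase n"
      define j where "j = n + 1 - c"
      have j: "1 \<le> r" "r < j" "j \<le> n" "c = n + 1 - j" using rc by (auto simp: staircase_def j_def)
      \<comment> \<open>Under betweenness the two sets coincide, so their sizes agree
        trivially.\<close>
      have "{k. r < k \<and> k < j \<and> T r k > T r j} = {k. r < k \<and> k < j \<and> T k j < T r j}"
        unfolding T_def using betweennessD[OF btw j(1)] j by fastforce
      then show "?bal r c" unfolding j(4) using bal_iff[OF j(1-3)] by simp
    qed
  qed
  then show ?thesis
    unfolding SBT_def rothe_longest_perm perm_length_longest_perm by blast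
qed

lemma SBT_longest_permD:
  assumes "R \<in> SBT n (longest_perm n)"
  shows "R \<in> extensional (staircase n)" "bij_betw R (staircase n) {1..n choose 2}"
    "inj_on R (staircase n)" "betweenness n R"
  using assms by (auto simp: SBT_longest_perm_iff bij_betw_def)

lemma SBT_longest_perm_range:
  assumes "R \<in> SBT n (longest_perm n)" "x \<in> staircase n"
  shows "1 \<le> R x" "R x \<le> n choose 2"
  using bij_betwE[OF SBT_longest_permD(2)[OF assms(1)]] assms(2) by auto

lemma cell_of_entry:
  assumes "R \<in> SBT n (longest_perm n)" "x \<in> staircase n"
  shows "cell_of n (longest_perm n) R (R x) = x"
  unfolding cell_of_def rothe_longest_perm
  by (rule inv_into_f_f[OF SBT_longest_permD(3)[OF assms(1)] assms(2)])

lemma cell_of_eqI: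
  assumes "R \<in> SBT n (longest_perm n)" "x \<in> staircase n" "R x = k"
  shows "cell_of n (longest_perm n) R k = x"
  using cell_of_entry[OF assms(1,2)] assms(3) by simp

lemma entry_cell_of:
  assumes "R \<in> SBT n (longest_perm n)" "1 \<le> k" "k \<le> n choose 2"
  shows "R (cell_of n (longest_perm n) R k) = k" "cell_of n (longest_perm n) R k \<in> staircase n"
proof -
  have "k \<in> R ` staircase n"
    using SBT_longest_permD(2)[OF assms(1)] assms by (auto simp: bij_betw_def)
  then show "R (cell_of n (longest_perm n) R k) = k" "cell_of n (longest_perm n) R k \<in> staircase n"
    unfolding cell_of_def rothe_longest_perm by (auto intro: f_inv_into_f inv_into_into)
qed

definition cell_pairs :: "nat \<Rightarrow> ((nat \<times> nat) \<times> (nat \<times> nat)) set" where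
  "cell_pairs n = {(x, y). x \<in> staircase n \<and> y \<in> staircase n \<and> fst x > fst y \<and> snd x \<noteq> snd y}"

lemma finite_cell_pairs: "finite (cell_pairs n)"
  by (rule finite_subset[of _ "staircase n \<times> staircase n"])
     (auto simp: cell_pairs_def finite_staircase)

text \<open>Passing from entries to their cells makes the set of candidate pairs independent of the
  filling; only the comparison of the two entries still depends on \<open>R\<close>.\<close>

lemma sbt_inv_eq_card:
  assumes "R \<in> SBT n (longest_perm n)"
  shows "sbt_inv n (longest_perm n) R = card {(x, y) \<in> cell_pairs n. R x < R y}"
proof -
  let ?q = "cell_of n (longest_perm n) R"
  show ?thesis
    unfolding sbt_inv_def perm_length_longest_perm
    by (rule bij_betw_same_card[of "\<lambda>(i, j). (?q i, ?q j)"],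
        rule bij_betw_byWitness[of _ "\<lambda>(x, y). (R x, R y)"])
       (auto simp: cell_pairs_def entry_cell_of[OF assms] cell_of_entry[OF assms]
          SBT_longest_perm_range[OF assms] simp del: One_nat_def)
qed

section \<open>Reversal of the entries\<close>

lemma psi_apply:
  assumes "R \<in> SBT n (longest_perm n)" "x \<in> staircase n"
  shows "psi n R x = (n choose 2) + 1 - R x"
  using SBT_longest_perm_range[OF assms] assms(2)
  by (simp add: psi_def rothe_longest_perm Suc_diff_le)

lemma psi_in_SBT:
  assumes "R \<in> SBT n (longest_perm n)"
  shows "psi n R \<in> SBT n (longest_perm n)"
proof -
  let ?N = "n choose 2"
  have "bij_betw (\<lambda>k. ?N + 1 - k) {1..?N} {1..?N}"
    by (rule bij_betw_byWitness[of _ "\<lambda>k. ?N + 1 - k"]) auto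
  then have "bij_betw ((\<lambda>k. ?N + 1 - k) \<circ> R) (staircase n) {1..?N}"
    by (rule bij_betw_trans[OF SBT_longest_permD(2)[OF assms]])
  then have bij: "bij_betw (psi n R) (staircase n) {1..?N}"
    by (rule bij_betw_cong[THEN iffD1, rotated]) (simp add: psi_apply[OF assms] del: One_nat_def)
  have "betweenness n (psi n R)"
    unfolding betweenness_def
  proof (intro allI impI, elim conjE)
    fix i k j assume ikj: "1 \<le> i" "i < k" "k < j" "j \<le> n"
    then have "(i, n + 1 - j) \<in> staircase n" "(k, n + 1 - j) \<in> staircase n" "(i, n + 1 - k) \<in> staircase n"
      by (auto simp: staircase_def)
    note D = this
    show "psi n R (i, n + 1 - k) < psi n R (i, n + 1 - j) \<and> psi n R (i, n + 1 - j) < psi n R (k, n + 1 - j) \<or>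
     psi n R (k, n + 1 - j) < psi n R (i, n + 1 - j) \<and> psi n R (i, n + 1 - j) < psi n R (i, n + 1 - k)"
      unfolding D[THEN psi_apply[OF assms]]
      using betweennessD[OF SBT_longest_permD(4)[OF assms] ikj]
        D[THEN SBT_longest_perm_range(2)[OF assms]]
      by linarith
  qed
  then show ?thesis
    using bij by (auto simp: SBT_longest_perm_iff psi_def rothe_longest_perm)
qed

lemma psi_psi:
  assumes "R \<in> SBT n (longest_perm n)"
  shows "psi n (psi n R) = R"
proof
  fix x
  show "psi n (psi n R) x = R x"
  proof (cases "x \<in> staircase n")
    case True
    then show ?thesis
      using SBT_longest_perm_range[OF assms True]
      by (simp add: psi_apply[OF psi_in_SBT[OF assms]] psi_apply[OF assms])
  next
    case False
    then show ?thesis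
      using extensional_arb[OF SBT_longest_permD(1)[OF assms]]
      by (simp add: psi_def rothe_longest_perm)
  qed
qed

text \<open>The two cells of a candidate pair carry distinct entries, so exactly one of
  \<open>R\<close> and \<open>psi n R\<close> counts it.\<close>

lemma sbt_inv_psi:
  assumes "R \<in> SBT n (longest_perm n)"
  shows "sbt_inv n (longest_perm n) (psi n R) + sbt_inv n (longest_perm n) R = card (cell_pairs n)"
proof -
  have psi: "psi n R x < psi n R y \<longleftrightarrow> \<not> R x < R y" if "(x, y) \<in> cell_pairs n" for x y
  proof -
    have xy: "x \<in> staircase n" "y \<in> staircase n" "x \<noteq> y" using that by (auto simp: cell_pairs_def)
    then have "R x \<noteq> R y" using SBT_longest_permD(3)[OF assms] by (auto dest: inj_onD)
    then show ?thesis
      using SBT_longest_perm_range[OF assms xy(1)] SBT_longest_perm_range[OF assms xy(2)]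
      unfolding psi_apply[OF assms xy(1)] psi_apply[OF assms xy(2)] by linarith
  qed
  have "{(x, y) \<in> cell_pairs n. psi n R x < psi n R y} = cell_pairs n - {(x, y) \<in> cell_pairs n. R x < R y}"
    using psi by auto
  then show ?thesis
    unfolding sbt_inv_eq_card[OF assms] sbt_inv_eq_card[OF psi_in_SBT[OF assms]]
    by (simp add: card_Diff_subset finite_cell_pairs finite_subset[OF _ finite_cell_pairs]
        card_mono subset_eq case_prod_unfold)
qed

section \<open>Exchanges of entries and order reversal\<close>

lemma exchange_apply:
  "x \<in> staircase n \<Longrightarrow> exchange n (longest_perm n) u v R x = transpose u v (R x)"
  by (simp add: exchange_def rothe_longest_perm)

lemma exchange_commute: "exchange n w u v R = exchange n w v u R"
  by (simp add: exchange_def transpose_commute)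

lemma exchange_exchange:
  assumes "R \<in> SBT n w"
  shows "exchange n w u v (exchange n w u v R) = R"
  using assms by (auto simp: exchange_def SBT_def extensional_def restrict_def)

lemma cell_of_exchange:
  assumes "R \<in> SBT n (longest_perm n)" "exchange n (longest_perm n) u v R \<in> SBT n (longest_perm n)"
    and "1 \<le> u" "u \<le> n choose 2" "1 \<le> v" "v \<le> n choose 2" "1 \<le> k" "k \<le> n choose 2"
  shows "cell_of n (longest_perm n) (exchange n (longest_perm n) u v R) k =
      cell_of n (longest_perm n) R (transpose u v k)"
proof (rule cell_of_eqI[OF assms(2)])
  have "1 \<le> transpose u v k" "transpose u v k \<le> n choose 2"
    using assms by (auto simp: transpose_def)
  note q = entry_cell_of[OF assms(1) this]
  show "cell_of n (longest_perm n) R (transpose u v k) \<in> staircase n" by (rule q)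
  then show "exchange n (longest_perm n) u v R (cell_of n (longest_perm n) R (transpose u v k)) = k"
    by (simp add: exchange_apply q)
qed

lemma cell_of_psi:
  assumes "R \<in> SBT n (longest_perm n)" "1 \<le> k" "k \<le> n choose 2"
  shows "cell_of n (longest_perm n) (psi n R) k = cell_of n (longest_perm n) R ((n choose 2) + 1 - k)"
proof (rule cell_of_eqI[OF psi_in_SBT[OF assms(1)]])
  have "1 \<le> (n choose 2) + 1 - k" "(n choose 2) + 1 - k \<le> n choose 2"
    using assms by auto
  note q = entry_cell_of[OF assms(1) this]
  show "cell_of n (longest_perm n) R ((n choose 2) + 1 - k) \<in> staircase n" by (rule q)
  then show "psi n R (cell_of n (longest_perm n) R ((n choose 2) + 1 - k)) = k"
    using assms psi_apply[OF assms(1) q(2)] q(1) by simp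
qed

lemma psi_exchange:
  assumes "R \<in> SBT n (longest_perm n)" "exchange n (longest_perm n) u v R \<in> SBT n (longest_perm n)"
    and "1 \<le> u" "u \<le> n choose 2" "1 \<le> v" "v \<le> n choose 2"
  shows "psi n (exchange n (longest_perm n) u v R) =
      exchange n (longest_perm n) ((n choose 2) + 1 - u) ((n choose 2) + 1 - v) (psi n R)"
proof
  fix x
  show "psi n (exchange n (longest_perm n) u v R) x =
      exchange n (longest_perm n) ((n choose 2) + 1 - u) ((n choose 2) + 1 - v) (psi n R) x"
  proof (cases "x \<in> staircase n")
    case True
    then show ?thesis
      using assms SBT_longest_perm_range[OF assms(1) True]
      by (simp add: psi_apply exchange_apply) (auto simp: transpose_def)
  next
    case False
    then show ?thesis by (simp add: psi_def exchange_def rothe_longest_perm)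
  qed
qed

text \<open>A nontrivial move is an exchange and is undone by the same exchange. Reversal conjugates
  it into an exchange at reflected entries, which is a move of the same kind from
  \<open>psi n S\<close> to \<open>psi n R\<close>; complementing the inversions turns the increase
  from \<open>R\<close> to \<open>S\<close> into one from \<open>psi n S\<close> to
  \<open>psi n R\<close>.\<close>

lemma sbt_gt1_psi:
  assumes "sbt_gt1 n (longest_perm n) R S"
  shows "sbt_gt1 n (longest_perm n) (psi n S) (psi n R)"
proof -
  let ?w = "longest_perm n" and ?N = "n choose 2"
  have R: "R \<in> SBT n ?w" and S: "S \<in> SBT n ?w" and inv: "sbt_inv n ?w S = sbt_inv n ?w R + 1"
    using assms by (auto simp: sbt_gt1_def)
  have inv': "sbt_inv n ?w (psi n R) = sbt_inv n ?w (psi n S) + 1"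
    using sbt_inv_psi[OF R] sbt_inv_psi[OF S] inv by linarith
  \<comment> \<open>This rules out the branch in which a move acts as the identity.\<close>
  have "S \<noteq> R" using inv by auto
  consider (c) i where "1 \<le> i" "i + 1 \<le> ?N" "S = move_c n ?w i R"
    | (b) i where "2 \<le> i" "i + 1 \<le> ?N" "S = move_b n ?w i R"
    using assms unfolding sbt_gt1_def perm_length_longest_perm by blast
  then have "(\<exists>i. 1 \<le> i \<and> i + 1 \<le> ?N \<and> psi n R = move_c n ?w i (psi n S)) \<or>
      (\<exists>i. 2 \<le> i \<and> i + 1 \<le> ?N \<and> psi n R = move_b n ?w i (psi n S))"
  proof cases
    case c
    have cond: "row_of n ?w R i \<noteq> row_of n ?w R (i + 1) \<and> col_of n ?w R i \<noteq> col_of n ?w R (i + 1)"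
      and SR: "S = exchange n ?w i (i + 1) R"
      using c(3) \<open>S \<noteq> R\<close> unfolding move_c_def by meson+
    have RS: "R = exchange n ?w i (i + 1) S" by (simp add: SR exchange_exchange[OF R])
    \<comment> \<open>Reversal sends \<open>i + 1\<close> and \<open>i\<close> to \<open>m\<close>
      and \<open>m + 1\<close>. Combined with the exchange, entry \<open>m\<close> of
      \<open>psi n S\<close> sits where \<open>i\<close> sits in \<open>R\<close>, and
      \<open>m + 1\<close> where \<open>i + 1\<close> does, so the condition of the move carries
      over.\<close>
    define m where "m = ?N - i"
    have m: "1 \<le> m" "m + 1 \<le> ?N" using c unfolding m_def by auto
    have eqs: "?N + 1 - i = m + 1" "?N + 1 - (i + 1) = m" "?N + 1 - m = i + 1" "?N + 1 - (m + 1) = i"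
      using c unfolding m_def by auto
    have ex: "exchange n ?w i (i + 1) R \<in> SBT n ?w" "exchange n ?w i (i + 1) S \<in> SBT n ?w"
      unfolding SR[symmetric] RS[symmetric] by (fact S R)+
    have "psi n R = exchange n ?w (m + 1) m (psi n S)"
      using psi_exchange[OF S ex(2)] c(1,2) unfolding eqs RS[symmetric] by simp
    then have psiR: "psi n R = exchange n ?w m (m + 1) (psi n S)"
      by (simp add: exchange_commute)
    have "cell_of n ?w (psi n S) m = cell_of n ?w S (i + 1)"
      "cell_of n ?w (psi n S) (m + 1) = cell_of n ?w S i"
      using cell_of_psi[OF S, of m] cell_of_psi[OF S, of "m + 1"] m unfolding eqs by auto
    moreover have "cell_of n ?w S (i + 1) = cell_of n ?w R i" "cell_of n ?w S i = cell_of n ?w R (i + 1)"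
      unfolding SR using cell_of_exchange[OF R ex(1)] c(1,2) by auto
    ultimately have "psi n R = move_c n ?w m (psi n S)"
      using cond by (simp add: move_c_def psiR)
    then show ?thesis using m by blast
  next
    case b
    have cond: "above_in_col n ?w R (i - 1) i \<and> right_in_row n ?w R (i + 1) i \<or>
         above_in_col n ?w R (i + 1) i \<and> right_in_row n ?w R (i - 1) i"
      and SR: "S = exchange n ?w (i - 1) (i + 1) R"
      using b(3) \<open>S \<noteq> R\<close> unfolding move_b_def by meson+
    have RS: "R = exchange n ?w (i - 1) (i + 1) S" by (simp add: SR exchange_exchange[OF R])
    \<comment> \<open>Here the reflected index is that of the middle entry. Exchange and reversal
      cancel: \<open>m - 1\<close>, \<open>m\<close>, \<open>m + 1\<close> occupy in
      \<open>psi n S\<close> the cells of \<open>i - 1\<close>, \<open>i\<close>,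
      \<open>i + 1\<close> in \<open>R\<close>.\<close>
    define m where "m = ?N + 1 - i"
    have m: "2 \<le> m" "m + 1 \<le> ?N" using b unfolding m_def by auto
    have eqs: "?N + 1 - (i - 1) = m + 1" "?N + 1 - (i + 1) = m - 1" "?N + 1 - (m - 1) = i + 1"
        "?N + 1 - (m + 1) = i - 1" "?N + 1 - m = i"
      using b unfolding m_def by auto
    have ex: "exchange n ?w (i - 1) (i + 1) R \<in> SBT n ?w" "exchange n ?w (i - 1) (i + 1) S \<in> SBT n ?w"
      unfolding SR[symmetric] RS[symmetric] by (fact S R)+
    have "psi n R = exchange n ?w (m + 1) (m - 1) (psi n S)"
      using psi_exchange[OF S ex(2)] b(1,2) unfolding eqs RS[symmetric] by simp
    then have psiR: "psi n R = exchange n ?w (m - 1) (m + 1) (psi n S)"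
      by (simp add: exchange_commute)
    have "cell_of n ?w (psi n S) (m - 1) = cell_of n ?w S (i + 1)"
      "cell_of n ?w (psi n S) (m + 1) = cell_of n ?w S (i - 1)"
      "cell_of n ?w (psi n S) m = cell_of n ?w S i"
      using cell_of_psi[OF S, of m] cell_of_psi[OF S, of "m + 1"] cell_of_psi[OF S, of "m - 1"] m
      unfolding eqs by auto
    moreover have "cell_of n ?w S (i + 1) = cell_of n ?w R (i - 1)" "cell_of n ?w S i = cell_of n ?w R i"
      "cell_of n ?w S (i - 1) = cell_of n ?w R (i + 1)"
      unfolding SR using cell_of_exchange[OF R ex(1)] b(1,2) by auto
    ultimately have "psi n R = move_b n ?w m (psi n S)"
      using cond by (simp add: move_b_def psiR above_in_col_def right_in_row_def)
    then show ?thesis using m by blast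
  qed
  then show ?thesis
    using psi_in_SBT[OF R] psi_in_SBT[OF S] inv' by (simp add: sbt_gt1_def perm_length_longest_perm)
qed

lemma sbt_less_psi:
  assumes "sbt_less n (longest_perm n) S R"
  shows "sbt_less n (longest_perm n) (psi n R) (psi n S)"
  using assms unfolding sbt_less_def
proof (induction rule: tranclp_induct)
  case (base S)
  then show ?case by (intro tranclp.r_into_trancl sbt_gt1_psi)
next
  case (step S T)
  \<comment> \<open>The last step of the chain becomes the first step of the reversed chain.\<close>
  then show ?case using sbt_gt1_psi[of n S T] by (meson tranclp_into_tranclp2)
qed

section \<open>Criteria for downward moves\<close>

text \<open>The exchange moves values only within the interval from \<open>u\<close> to
  \<open>v\<close>, so a comparison with a value outside that interval survives.\<close>

lemma transpose_less_outside:
  fixes p q u v :: nat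
  assumes "p < q" "u < v" "\<not> (u \<le> p \<and> q \<le> v)"
  shows "transpose u v p < transpose u v q"
  using assms by (auto simp: transpose_def)

lemma exchange_in_SBT:
  assumes "R \<in> SBT n (longest_perm n)"
    and "1 \<le> u" "u \<le> n choose 2" "1 \<le> v" "v \<le> n choose 2"
    and "betweenness n (exchange n (longest_perm n) u v R)"
  shows "exchange n (longest_perm n) u v R \<in> SBT n (longest_perm n)"
proof -
  have "bij_betw (transpose u v) {1..n choose 2} {1..n choose 2}"
    by (rule bij_betw_byWitness[of _ "transpose u v"]) (use assms in \<open>auto simp: transpose_def\<close>)
  then have "bij_betw (transpose u v \<circ> R) (staircase n) {1..n choose 2}"
    by (rule bij_betw_trans[OF SBT_longest_permD(2)[OF assms(1)]])
  then have "bij_betw (exchange n (longest_perm n) u v R) (staircase n) {1..n choose 2}"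
    by (rule bij_betw_cong[THEN iffD1, rotated]) (simp add: exchange_apply)
  then show ?thesis
    using assms(6) by (simp add: SBT_longest_perm_iff) (simp add: exchange_def rothe_longest_perm)
qed

text \<open>\<open>P\<close> marks the triples on which the exchange swaps the two alternatives of
  betweenness: their outer entries are \<open>u\<close> and \<open>v\<close>, around a fixed middle
  entry. In every other triple neither of the two compared pairs lies within the interval, so the
  comparisons are unchanged. Commutation moves take \<open>P\<close> empty, braid moves a single
  triple.\<close>

lemma betweenness_exchangeI:
  assumes "betweenness n R" and "u < v"
    and row: "\<And>i k j. 1 \<le> i \<Longrightarrow> i < k \<Longrightarrow> k < j \<Longrightarrow> j \<le> n \<Longrightarrow> \<not> P i k j \<Longrightarrow>
      \<not> {R (i, n + 1 - k), R (i, n + 1 - j)} \<subseteq> {u..v}"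
    and col: "\<And>i k j. 1 \<le> i \<Longrightarrow> i < k \<Longrightarrow> k < j \<Longrightarrow> j \<le> n \<Longrightarrow> \<not> P i k j \<Longrightarrow>
      \<not> {R (k, n + 1 - j), R (i, n + 1 - j)} \<subseteq> {u..v}"
    and flip: "\<And>i k j. 1 \<le> i \<Longrightarrow> i < k \<Longrightarrow> k < j \<Longrightarrow> j \<le> n \<Longrightarrow> P i k j \<Longrightarrow>
      {R (i, n + 1 - k), R (k, n + 1 - j)} = {u, v} \<and> R (i, n + 1 - j) \<in> {u<..<v}"
  shows "betweenness n (exchange n (longest_perm n) u v R)"
  unfolding betweenness_def
proof (intro allI impI, elim conjE)
  fix i k j assume ikj: "1 \<le> i" "i < k" "k < j" "j \<le> n"
  let ?ik = "R (i, n + 1 - k)" and ?ij = "R (i, n + 1 - j)" and ?kj = "R (k, n + 1 - j)"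
  let ?t = "transpose u v"
  have D: "(i, n + 1 - j) \<in> staircase n" "(k, n + 1 - j) \<in> staircase n" "(i, n + 1 - k) \<in> staircase n"
    using ikj by (auto simp: staircase_def)
  have "?t ?ik < ?t ?ij \<and> ?t ?ij < ?t ?kj \<or> ?t ?kj < ?t ?ij \<and> ?t ?ij < ?t ?ik"
  proof (cases "P i k j")
    case True
    then show ?thesis
      using flip[OF ikj True] \<open>u < v\<close> by (auto simp: doubleton_eq_iff transpose_def)
  next
    case False
    have "\<not> (u \<le> ?ik \<and> ?ij \<le> v)" if "?ik < ?ij" using row[OF ikj False] that by auto
    moreover have "\<not> (u \<le> ?ij \<and> ?ik \<le> v)" if "?ij < ?ik" using row[OF ikj False] that by auto
    moreover have "\<not> (u \<le> ?kj \<and> ?ij \<le> v)" if "?kj < ?ij" using col[OF ikj False] that by auto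
    moreover have "\<not> (u \<le> ?ij \<and> ?kj \<le> v)" if "?ij < ?kj" using col[OF ikj False] that by auto
    ultimately show ?thesis
      using betweennessD[OF assms(1) ikj] transpose_less_outside[OF _ \<open>u < v\<close>] by meson
  qed
  then show "exchange n (longest_perm n) u v R (i, n + 1 - k) < exchange n (longest_perm n) u v R (i, n + 1 - j) \<and>
      exchange n (longest_perm n) u v R (i, n + 1 - j) < exchange n (longest_perm n) u v R (k, n + 1 - j) \<or>
      exchange n (longest_perm n) u v R (k, n + 1 - j) < exchange n (longest_perm n) u v R (i, n + 1 - j) \<and>
      exchange n (longest_perm n) u v R (i, n + 1 - j) < exchange n (longest_perm n) u v R (i, n + 1 - k)"
    unfolding D[THEN exchange_apply] .
qed

text \<open>Apart from \<open>x\<close> and \<open>y\<close> themselves, only comparisons of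
  \<open>x\<close> or \<open>y\<close> with a cell of intermediate entry can change. By
  \<open>mid\<close> such a cell shares a row or column with each of them and hence forms no
  candidate pair with either, so the only change is that \<open>(y, x)\<close> becomes an
  inversion.\<close>

lemma sbt_inv_exchange:
  assumes R: "R \<in> SBT n (longest_perm n)"
    and S: "exchange n (longest_perm n) (R x) (R y) R \<in> SBT n (longest_perm n)"
    and yx: "(y, x) \<in> cell_pairs n" and less: "R x < R y"
    and mid: "\<And>z. z \<in> staircase n \<Longrightarrow> R x < R z \<Longrightarrow> R z < R y \<Longrightarrow>
      (fst z = fst x \<or> snd z = snd x) \<and> (fst z = fst y \<or> snd z = snd y)"
  shows "sbt_inv n (longest_perm n) (exchange n (longest_perm n) (R x) (R y) R) =
      sbt_inv n (longest_perm n) R + 1"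
proof -
  let ?S = "exchange n (longest_perm n) (R x) (R y) R"
  have x: "x \<in> staircase n" and y: "y \<in> staircase n" using yx by (auto simp: cell_pairs_def)
  have inj: "R p = R q \<longleftrightarrow> p = q" if "p \<in> staircase n" "q \<in> staircase n" for p q
    using inj_on_eq_iff[OF SBT_longest_permD(3)[OF R]] that by blast
  have key: "?S p < ?S q \<longleftrightarrow> p = y \<and> q = x \<or> R p < R q" if pq: "(p, q) \<in> cell_pairs n" for p q
  proof -
    have D: "p \<in> staircase n" "q \<in> staircase n" "fst q < fst p" "snd p \<noteq> snd q"
      using pq by (auto simp: cell_pairs_def)
    note eqs = inj[OF D(1) x] inj[OF D(1) y] inj[OF D(2) x] inj[OF D(2) y]
    have ne: "R p \<noteq> R q" using D inj[OF D(1,2)] by auto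
    have fyx: "fst x < fst y" "snd x \<noteq> snd y" using yx by (auto simp: cell_pairs_def)
    consider "p = x" | "p = y" "q = x" | "p = y" "q \<noteq> x" | "p \<noteq> x" "p \<noteq> y" "q = x"
      | "p \<noteq> x" "p \<noteq> y" "q = y" | "p \<noteq> x" "p \<noteq> y" "q \<noteq> x" "q \<noteq> y" by blast
    then have "transpose (R x) (R y) (R p) < transpose (R x) (R y) (R q) \<longleftrightarrow> p = y \<and> q = x \<or> R p < R q"
    proof cases
      case 1
      then have "q \<noteq> x" "q \<noteq> y" using D fyx by auto
      moreover have "\<not> (R x < R q \<and> R q < R y)" using mid[OF D(2)] D 1 by auto
      ultimately show ?thesis using 1 less ne fyx D eqs by (auto simp: transpose_def)
    next
      case 2
      then show ?thesis using less eqs by (auto simp: transpose_def)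
    next
      case 3
      moreover have "q \<noteq> y" using 3 D by auto
      moreover have "\<not> (R x < R q \<and> R q < R y)" using mid[OF D(2)] D 3 by auto
      ultimately show ?thesis using less ne eqs by (auto simp: transpose_def)
    next
      case 4
      moreover have "\<not> (R x < R p \<and> R p < R y)" using mid[OF D(1)] D 4 by auto
      ultimately show ?thesis using less ne eqs by (auto simp: transpose_def)
    next
      case 5
      moreover have "\<not> (R x < R p \<and> R p < R y)" using mid[OF D(1)] D 5 by auto
      ultimately show ?thesis using less ne eqs by (auto simp: transpose_def)
    next
      case 6
      then show ?thesis using eqs by (simp add: transpose_def)
    qed
    then show ?thesis by (simp only: exchange_apply[OF D(1)] exchange_apply[OF D(2)])
  qed
  have "{(p, q) \<in> cell_pairs n. ?S p < ?S q} = insert (y, x) {(p, q) \<in> cell_pairs n. R p < R q}"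
    using key yx by auto
  moreover have "finite {(p, q) \<in> cell_pairs n. R p < R q}"
    by (rule finite_subset[OF _ finite_cell_pairs]) auto
  moreover have "(y, x) \<notin> {(p, q) \<in> cell_pairs n. R p < R q}" using less by auto
  ultimately show ?thesis by (simp add: sbt_inv_eq_card[OF R] sbt_inv_eq_card[OF S])
qed

lemma sbt_gt1_move_c:
  assumes R: "R \<in> SBT n (longest_perm n)" and i: "1 \<le> i" "i + 1 \<le> n choose 2"
    and row: "row_of n (longest_perm n) R i < row_of n (longest_perm n) R (i + 1)"
    and col: "col_of n (longest_perm n) R i \<noteq> col_of n (longest_perm n) R (i + 1)"
  shows "sbt_gt1 n (longest_perm n) R (move_c n (longest_perm n) i R)"
proof -
  let ?w = "longest_perm n"
  define x y where "x = cell_of n ?w R i" and "y = cell_of n ?w R (i + 1)"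
  have x: "x \<in> staircase n" "R x = i" and y: "y \<in> staircase n" "R y = i + 1"
    using entry_cell_of[OF R] i unfolding x_def y_def by auto
  have xy: "fst x < fst y" "snd x \<noteq> snd y" using row col unfolding x_def y_def by auto
  have eq: "z = x" if "z \<in> staircase n" "R z = i" for z
    using cell_of_eqI[OF R that] unfolding x_def by simp
  have eq': "z = y" if "z \<in> staircase n" "R z = i + 1" for z
    using cell_of_eqI[OF R that] unfolding y_def by simp
  \<comment> \<open>The entries \<open>i\<close> and \<open>i + 1\<close> share neither row nor
    column, whereas betweenness compares only cells that share one. Hence no triple has to
    flip.\<close>
  have no: "\<not> {R p, R q} \<subseteq> {i..i + 1}"
    if "p \<in> staircase n" "q \<in> staircase n" "p \<noteq> q" "fst p = fst q \<or> snd p = snd q" for p q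
  proof
    assume "{R p, R q} \<subseteq> {i..i + 1}"
    then have "R p = i \<or> R p = i + 1" "R q = i \<or> R q = i + 1" by auto
    then have "p = x \<or> p = y" "q = x \<or> q = y"
      using eq eq' that(1,2) by blast+
    then show False using that xy by auto
  qed
  have "betweenness n (exchange n ?w i (i + 1) R)"
  proof (rule betweenness_exchangeI[OF SBT_longest_permD(4)[OF R], of _ _ "\<lambda>_ _ _. False"])
    fix l k j assume lkj: "1 \<le> l" "l < k" "k < j" "j \<le> n"
    have D: "(l, n + 1 - j) \<in> staircase n" "(k, n + 1 - j) \<in> staircase n" "(l, n + 1 - k) \<in> staircase n"
      using lkj by (auto simp: staircase_def)
    show "\<not> {R (l, n + 1 - k), R (l, n + 1 - j)} \<subseteq> {i..i + 1}"
      by (rule no[OF D(3,1)]) (use lkj in auto)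
    show "\<not> {R (k, n + 1 - j), R (l, n + 1 - j)} \<subseteq> {i..i + 1}"
      by (rule no[OF D(2,1)]) (use lkj in auto)
  qed auto
  then have S: "exchange n ?w i (i + 1) R \<in> SBT n ?w"
    by (rule exchange_in_SBT[OF R, rotated -1]) (use i in auto)
  have move: "move_c n ?w i R = exchange n ?w i (i + 1) R"
    using row col by (simp add: move_c_def)
  have "sbt_inv n ?w (exchange n ?w i (i + 1) R) = sbt_inv n ?w R + 1"
    \<comment> \<open>No entry lies strictly between \<open>i\<close> and \<open>i + 1\<close>, so
      the condition on intermediate cells is vacuous.\<close>
    by (rule sbt_inv_exchange[OF R, of x y, unfolded x y])
       (use S x y xy in \<open>auto simp: cell_pairs_def\<close>)
  then show ?thesis
    using R S i move unfolding sbt_gt1_def perm_length_longest_perm by metis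
qed

lemma sbt_gt1_move_b:
  assumes R: "R \<in> SBT n (longest_perm n)" and m: "2 \<le> m" "m + 1 \<le> n choose 2"
    and abc: "1 \<le> a" "a < b" "b < c" "c \<le> n"
    and ab: "R (a, n + 1 - b) = m - 1" and ac: "R (a, n + 1 - c) = m" and bc: "R (b, n + 1 - c) = m + 1"
  shows "sbt_gt1 n (longest_perm n) R (move_b n (longest_perm n) m R)"
proof -
  let ?w = "longest_perm n"
  let ?ab = "(a, n + 1 - b)" and ?ac = "(a, n + 1 - c)" and ?bc = "(b, n + 1 - c)"
  have D: "?ab \<in> staircase n" "?ac \<in> staircase n" "?bc \<in> staircase n"
    using abc by (auto simp: staircase_def)
  note q = cell_of_eqI[OF R D(1) ab] cell_of_eqI[OF R D(2) ac] cell_of_eqI[OF R D(3) bc]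
  have three: "z \<in> {?ab, ?ac, ?bc}" if "z \<in> staircase n" "m - 1 \<le> R z" "R z \<le> m + 1" for z
  proof -
    consider "R z = m - 1" | "R z = m" | "R z = m + 1" using \<open>m - 1 \<le> R z\<close> \<open>R z \<le> m + 1\<close> by linarith
    then show ?thesis using q cell_of_entry[OF R that(1)] by cases auto
  qed
  \<comment> \<open>The three consecutive entries fill exactly the cells of the triple
    \<open>a\<close>, \<open>b\<close>, \<open>c\<close>. Among these, \<open>?ab\<close> and
    \<open>?ac\<close> are the only two in one row, \<open>?ac\<close> and \<open>?bc\<close> the
    only two in one column; either pair determines the triple, so all others are unaffected.\<close>
  let ?P = "\<lambda>i k j. i = a \<and> k = b \<and> j = c"
  have "betweenness n (exchange n ?w (m - 1) (m + 1) R)"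
  proof (rule betweenness_exchangeI[OF SBT_longest_permD(4)[OF R], of _ _ ?P])
    fix i k j assume ikj: "1 \<le> i" "i < k" "k < j" "j \<le> n" "\<not> ?P i k j"
    have D': "(i, n + 1 - j) \<in> staircase n" "(k, n + 1 - j) \<in> staircase n" "(i, n + 1 - k) \<in> staircase n"
      using ikj by (auto simp: staircase_def)
    have inj: "n + 1 - p = n + 1 - q \<longleftrightarrow> p = q" if "p \<le> n" "q \<le> n" for p q
      using that by linarith
    have "k \<le> n" "b \<le> n" using ikj abc by auto
    note inj = inj[OF \<open>j \<le> n\<close> \<open>c \<le> n\<close>] inj[OF \<open>j \<le> n\<close> \<open>b \<le> n\<close>] inj[OF \<open>k \<le> n\<close> \<open>c \<le> n\<close>]
      inj[OF \<open>k \<le> n\<close> \<open>b \<le> n\<close>]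
    show "\<not> {R (i, n + 1 - k), R (i, n + 1 - j)} \<subseteq> {m - 1..m + 1}"
    proof
      assume "{R (i, n + 1 - k), R (i, n + 1 - j)} \<subseteq> {m - 1..m + 1}"
      then have "(i, n + 1 - k) \<in> {?ab, ?ac, ?bc}" "(i, n + 1 - j) \<in> {?ab, ?ac, ?bc}"
        by (intro three D'; simp)+
      then show False
        unfolding insert_iff empty_iff prod.inject inj using ikj(2,3,5) abc(2,3) by linarith
    qed
    show "\<not> {R (k, n + 1 - j), R (i, n + 1 - j)} \<subseteq> {m - 1..m + 1}"
    proof
      assume "{R (k, n + 1 - j), R (i, n + 1 - j)} \<subseteq> {m - 1..m + 1}"
      then have "(k, n + 1 - j) \<in> {?ab, ?ac, ?bc}" "(i, n + 1 - j) \<in> {?ab, ?ac, ?bc}"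
        by (intro three D'; simp)+
      then show False
        unfolding insert_iff empty_iff prod.inject inj using ikj(2,3,5) abc(2,3) by linarith
    qed
  qed (use m ab ac bc in auto)
  then have S: "exchange n ?w (m - 1) (m + 1) R \<in> SBT n ?w"
    by (rule exchange_in_SBT[OF R, rotated -1]) (use m in auto)
  have "n + 1 - c < n + 1 - b" using abc by linarith
  then have move: "move_b n ?w m R = exchange n ?w (m - 1) (m + 1) R"
    using abc unfolding move_b_def above_in_col_def right_in_row_def q by simp
  have "sbt_inv n ?w (exchange n ?w (m - 1) (m + 1) R) = sbt_inv n ?w R + 1"
  proof (rule sbt_inv_exchange[OF R, of ?ab ?bc, unfolded ab bc])
    show "exchange n ?w (m - 1) (m + 1) R \<in> SBT n ?w" by (rule S)
    show "(?bc, ?ab) \<in> cell_pairs n"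
      using D abc by (auto simp: cell_pairs_def)
    show "m - 1 < m + 1" by simp
    fix z assume z: "z \<in> staircase n" "m - 1 < R z" "R z < m + 1"
    then have "R z = m" by linarith
    \<comment> \<open>The only intermediate cell is the corner of the hook, in the row of
      \<open>?ab\<close> and the column of \<open>?bc\<close>.\<close>
    then have "z = ?ac" using q(2) cell_of_entry[OF R z(1)] by simp
    then show "(fst z = fst ?ab \<or> snd z = snd ?ab) \<and> (fst z = fst ?bc \<or> snd z = snd ?bc)" by simp
  qed
  then show ?thesis
    using R S m move unfolding sbt_gt1_def perm_length_longest_perm by metis
qed

section \<open>The first row ascent of a filling\<close>

text \<open>Let \<open>m\<close> be the entry of \<open>(a, c)\<close>, so that
  \<open>(a, d)\<close> and \<open>(b, c)\<close> carry \<open>m - 1\<close> and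
  \<open>m + 1\<close>. If \<open>d\<close> differs from \<open>b\<close>, the entry of
  \<open>(a, b)\<close> is below \<open>m - 1\<close>, and betweenness on the three triples
  containing \<open>d\<close> leaves no room between consecutive values.\<close>

lemma consecutive_column_ascent:
  assumes R: "R \<in> SBT n (longest_perm n)"
    and abc: "1 \<le> a" "a < b" "b < c" "c \<le> n"
    and d: "a < d" "d \<le> n"
    and less: "R (a, n + 1 - b) < R (a, n + 1 - c)"
    and ad: "R (a, n + 1 - d) + 1 = R (a, n + 1 - c)" and bc: "R (b, n + 1 - c) = R (a, n + 1 - c) + 1"
  shows "d = b"
proof (rule ccontr)
  assume "d \<noteq> b"
  have "d \<noteq> c" using ad by auto
  have D: "(i, n + 1 - j) \<in> staircase n" if "1 \<le> i" "i < j" "j \<le> n" for i j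
    using that by (auto simp: staircase_def)
  have inj: "R (i, n + 1 - j) \<noteq> R (i', n + 1 - j')"
    if "1 \<le> i" "i < j" "j \<le> n" "1 \<le> i'" "i' < j'" "j' \<le> n" "i \<noteq> i' \<or> j \<noteq> j'" for i j i' j'
    using inj_on_eq_iff[OF SBT_longest_permD(3)[OF R] D D, of i j i' j'] that by auto
  note btw = betweennessD[OF SBT_longest_permD(4)[OF R]]
  have "R (a, n + 1 - b) \<noteq> R (a, n + 1 - d)" using inj[of a b a d] \<open>d \<noteq> b\<close> abc d by auto
  then have ab: "R (a, n + 1 - b) < R (a, n + 1 - d)" using less ad by linarith
  consider "d < b" | "b < d" "d < c" | "c < d" using \<open>d \<noteq> b\<close> \<open>d \<noteq> c\<close> by linarith
  then show False
  proof cases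
    case 1
    \<comment> \<open>The entry of \<open>(d, c)\<close> would lie strictly between \<open>m\<close>
      and \<open>m + 1\<close>.\<close>
    have "R (d, n + 1 - b) < R (a, n + 1 - b)" using btw[of a d b] 1 abc d ab by auto
    moreover have "R (a, n + 1 - c) < R (d, n + 1 - c)" using btw[of a d c] 1 abc d ad by auto
    moreover have "R (d, n + 1 - c) < R (b, n + 1 - c)"
      using btw[of d b c] 1 abc d calculation bc less by auto
    ultimately show False using bc by linarith
  next
    case 2
    \<comment> \<open>The entries of \<open>(b, d)\<close> and \<open>(d, c)\<close> are both at
      least \<open>m + 1\<close>, yet \<open>m + 1\<close> at \<open>(b, c)\<close> should lie
      strictly between them.\<close>
    have "R (a, n + 1 - d) < R (b, n + 1 - d)" using btw[of a b d] 2 abc d ab by auto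
    moreover have "R (b, n + 1 - d) \<noteq> R (a, n + 1 - c)" using inj[of b d a c] 2 abc d by auto
    moreover have "R (a, n + 1 - c) < R (d, n + 1 - c)" using btw[of a d c] 2 abc d ad by auto
    moreover have "R (b, n + 1 - c) \<le> R (b, n + 1 - d)" "R (b, n + 1 - c) \<le> R (d, n + 1 - c)"
      using calculation ad bc by linarith+
    ultimately show False using btw[of b d c] 2 abc d by auto
  next
    case 3
    \<comment> \<open>The entry of \<open>(b, d)\<close> is at least \<open>m + 1\<close>, while
      those of \<open>(b, c)\<close> and \<open>(c, d)\<close>, which should enclose it strictly,
      are at most \<open>m + 1\<close>.\<close>
    have "R (a, n + 1 - d) < R (b, n + 1 - d)" using btw[of a b d] 3 abc d ab by auto
    moreover have "R (b, n + 1 - d) \<noteq> R (a, n + 1 - c)" using inj[of b d a c] 3 abc d by auto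
    moreover have "R (c, n + 1 - d) < R (a, n + 1 - d)" using btw[of a c d] 3 abc d ad by auto
    moreover have "R (b, n + 1 - c) \<le> R (b, n + 1 - d)" "R (c, n + 1 - d) \<le> R (b, n + 1 - d)"
      using calculation ad bc by linarith+
    ultimately show False using btw[of b c d] 3 abc d by auto
  qed
qed

text \<open>Strong induction makes an ascent at \<open>i\<close> the first one, so rows weakly
  decrease along the entries up to \<open>i\<close>; this is what locates \<open>i - 1\<close> for
  the braid move.\<close>

lemma rows_antimono_if_minimal:
  assumes R: "R \<in> SBT n (longest_perm n)" and min: "\<And>S. \<not> sbt_gt1 n (longest_perm n) R S"
  shows "1 \<le> i \<Longrightarrow> i + 1 \<le> n choose 2 \<Longrightarrow>
    row_of n (longest_perm n) R (i + 1) \<le> row_of n (longest_perm n) R i"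
proof (induction i rule: less_induct)
  case (less i)
  let ?w = "longest_perm n"
  let ?q = "cell_of n ?w R"
  have mono: "fst (?q l) \<le> fst (?q k)" if "1 \<le> k" "k \<le> l" "l \<le> i" for k l
    using that(2,3)
  proof (induction l rule: dec_induct)
    case (step l)
    then have "fst (?q (l + 1)) \<le> fst (?q l)"
      using less.IH[of l] less.prems that by auto
    then show ?case using step by auto
  qed simp
  show ?case
  proof (rule ccontr)
    assume "\<not> ?case"
    then have asc: "fst (?q i) < fst (?q (i + 1))" by simp
    then have col: "snd (?q i) = snd (?q (i + 1))"
      using sbt_gt1_move_c[OF R less.prems] min by blast
    define a b c where "a = fst (?q i)" and "b = fst (?q (i + 1))" and "c = n + 1 - snd (?q i)"
    have qi: "?q i \<in> staircase n" "R (?q i) = i" "?q (i + 1) \<in> staircase n" "R (?q (i + 1)) = i + 1"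
      using entry_cell_of[OF R] less.prems by auto
    have snd: "snd (?q i) = n + 1 - c" using qi(1) unfolding c_def by (auto simp: staircase_def)
    have cells: "?q i = (a, n + 1 - c)" "?q (i + 1) = (b, n + 1 - c)"
      using snd col unfolding a_def b_def by (auto simp: prod_eq_iff)
    have abc: "1 \<le> a" "a < b" "b < c" "c \<le> n"
      using qi(1,3) asc col unfolding a_def b_def c_def by (auto simp: staircase_def)
    have ac: "R (a, n + 1 - c) = i" and bc: "R (b, n + 1 - c) = i + 1" using qi cells by auto
    have ab: "R (a, n + 1 - b) < i"
      using betweennessD[OF SBT_longest_permD(4)[OF R] abc] ac bc by linarith
    define p where "p = R (a, n + 1 - b)"
    have Dab: "(a, n + 1 - b) \<in> staircase n" using abc by (auto simp: staircase_def)
    have p: "1 \<le> p" "p < i" using SBT_longest_perm_range[OF R Dab] ab unfolding p_def by auto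
    have qp: "?q p = (a, n + 1 - b)" using cell_of_entry[OF R Dab] unfolding p_def by simp
    \<comment> \<open>The entries \<open>p\<close> and \<open>i\<close> both lie in row
      \<open>a\<close>, so by monotonicity every entry between them does, in particular
      \<open>i - 1\<close>.\<close>
    have "fst (?q (i - 1)) \<le> a" using mono[of p "i - 1"] p qp by simp
    moreover have "a \<le> fst (?q (i - 1))" using mono[of "i - 1" i] p by (simp add: a_def)
    ultimately have row: "fst (?q (i - 1)) = a" by simp
    have qi1: "?q (i - 1) \<in> staircase n" "R (?q (i - 1)) = i - 1"
      using entry_cell_of[OF R, of "i - 1"] less.prems p by auto
    define d where "d = n + 1 - snd (?q (i - 1))"
    have d: "a < d" "d \<le> n" "?q (i - 1) = (a, n + 1 - d)"
      using qi1(1) row unfolding d_def by (auto simp: staircase_def prod_eq_iff)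
    have "d = b"
      by (rule consecutive_column_ascent[OF R abc d(1,2)])
         (use ab ac bc qi1(2) d(3) p in auto)
    then have "R (a, n + 1 - b) = i - 1" using qi1(2) d(3) by simp
    then have "sbt_gt1 n ?w R (move_b n ?w i R)"
      by (intro sbt_gt1_move_b[OF R _ _ abc]) (use ac bc p less.prems in auto)
    then show False using min by blast
  qed
qed

section \<open>The row reading filling\<close>

definition reads_before :: "nat \<times> nat \<Rightarrow> nat \<times> nat \<Rightarrow> bool" where
  "reads_before x y \<longleftrightarrow> fst x > fst y \<or> fst x = fst y \<and> snd x < snd y"

lemma reads_before_total: "x \<noteq> y \<Longrightarrow> reads_before x y \<or> reads_before y x"
  by (auto simp: reads_before_def prod_eq_iff)

text \<open>The rank of a cell in reading order; counting the cell itself makes the entries start at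
  1.\<close>

definition row_reading :: "nat \<Rightarrow> nat \<times> nat \<Rightarrow> nat" where
  "row_reading n = restrict (\<lambda>x. card {y \<in> staircase n. y = x \<or> reads_before y x}) (staircase n)"

lemma row_reading_less:
  assumes "x \<in> staircase n" "y \<in> staircase n" "reads_before x y"
  shows "row_reading n x < row_reading n y"
proof -
  have "{z \<in> staircase n. z = x \<or> reads_before z x} \<subset> {z \<in> staircase n. z = y \<or> reads_before z y}"
  proof (rule psubsetI)
    show "{z \<in> staircase n. z = x \<or> reads_before z x} \<subseteq> {z \<in> staircase n. z = y \<or> reads_before z y}"
      using assms(3) by (auto simp: reads_before_def)
    have "y \<notin> {z \<in> staircase n. z = x \<or> reads_before z x}"
      using assms(3) by (auto simp: reads_before_def)
    then show "{z \<in> staircase n. z = x \<or> reads_before z x} \<noteq> {z \<in> staircase n. z = y \<or> reads_before z y}"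
      using assms(2) by blast
  qed
  then show ?thesis
    using assms(1,2) by (simp add: row_reading_def psubset_card_mono finite_staircase)
qed

lemma row_reading_in_SBT: "row_reading n \<in> SBT n (longest_perm n)"
proof -
  have inj: "inj_on (row_reading n) (staircase n)"
    by (rule inj_onI) (metis row_reading_less reads_before_total less_irrefl)
  have "row_reading n ` staircase n \<subseteq> {1..n choose 2}"
  proof clarify
    fix r c assume x: "(r, c) \<in> staircase n"
    let ?A = "{y \<in> staircase n. y = (r, c) \<or> reads_before y (r, c)}"
    have "card ?A \<le> card (staircase n)"
      by (rule card_mono[OF finite_staircase]) auto
    moreover have "card ?A \<noteq> 0" using x finite_staircase[of n] by (auto simp: card_eq_0_iff)
    ultimately show "row_reading n (r, c) \<in> {1..n choose 2}"
      using x by (simp add: row_reading_def card_staircase)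
  qed
  then have "row_reading n ` staircase n = {1..n choose 2}"
    by (rule card_subset_eq[rotated]) (simp_all add: card_image[OF inj] card_staircase)
  then have "bij_betw (row_reading n) (staircase n) {1..n choose 2}"
    using inj by (simp add: bij_betw_def)
  moreover have "betweenness n (row_reading n)"
    unfolding betweenness_def
  \<comment> \<open>The same alternative holds for every triple: the cell of \<open>(k, j)\<close>
    is in a higher row, and that of \<open>(i, k)\<close> is to the right of that of
    \<open>(i, j)\<close>.\<close>
  proof (intro allI impI disjI2 conjI; elim conjE)
    fix i k j assume ikj: "1 \<le> i" "i < k" "k < j" "j \<le> n"
    then have D: "(i, n + 1 - j) \<in> staircase n" "(k, n + 1 - j) \<in> staircase n" "(i, n + 1 - k) \<in> staircase n"
      by (auto simp: staircase_def)
    show "row_reading n (k, n + 1 - j) < row_reading n (i, n + 1 - j)"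
      by (rule row_reading_less[OF D(2,1)]) (use ikj in \<open>auto simp: reads_before_def\<close>)
    show "row_reading n (i, n + 1 - j) < row_reading n (i, n + 1 - k)"
      by (rule row_reading_less[OF D(1,3)]) (use ikj in \<open>auto simp: reads_before_def\<close>)
  qed
  ultimately show ?thesis
    by (simp add: SBT_longest_perm_iff) (simp add: row_reading_def)
qed

lemma sbt_inv_le: "R \<in> SBT n (longest_perm n) \<Longrightarrow> sbt_inv n (longest_perm n) R \<le> card (cell_pairs n)"
  using sbt_inv_psi[of R n] by simp

lemma sbt_inv_row_reading: "sbt_inv n (longest_perm n) (row_reading n) = card (cell_pairs n)"
proof -
  have "{(x, y) \<in> cell_pairs n. row_reading n x < row_reading n y} = cell_pairs n"
    by (auto simp: cell_pairs_def reads_before_def intro!: row_reading_less)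
  then show ?thesis by (simp add: sbt_inv_eq_card[OF row_reading_in_SBT])
qed

section \<open>Existence and uniqueness of the minimal element\<close>

lemma sbt_minimal_iff:
  "sbt_minimal n w R \<longleftrightarrow> R \<in> SBT n w \<and> (\<forall>S. \<not> sbt_gt1 n w R S)"
proof
  assume "sbt_minimal n w R"
  then show "R \<in> SBT n w \<and> (\<forall>S. \<not> sbt_gt1 n w R S)"
    unfolding sbt_minimal_def sbt_less_def
    using sbt_gt1_def[of n w R] tranclp.r_into_trancl[of "sbt_gt1 n w" R] by blast
next
  assume "R \<in> SBT n w \<and> (\<forall>S. \<not> sbt_gt1 n w R S)"
  then show "sbt_minimal n w R"
    unfolding sbt_minimal_def sbt_less_def by (auto dest: tranclpD)
qed

text \<open>A generating step would raise the inversion number above its maximum.\<close>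

lemma sbt_minimal_row_reading: "sbt_minimal n (longest_perm n) (row_reading n)"
  unfolding sbt_minimal_iff
proof (intro conjI allI notI row_reading_in_SBT)
  fix S assume "sbt_gt1 n (longest_perm n) (row_reading n) S"
  then show False
    using sbt_inv_le[of S n] sbt_inv_row_reading[of n] by (simp add: sbt_gt1_def)
qed

text \<open>Row monotonicity orders cells in different rows; betweenness then orders cells within a
  row. So the entries increase in reading order and must be the ranks.\<close>

lemma sbt_minimal_unique:
  assumes "sbt_minimal n (longest_perm n) R"
  shows "R = row_reading n"
proof -
  let ?w = "longest_perm n"
  let ?q = "cell_of n ?w R"
  have R: "R \<in> SBT n ?w" and min: "\<And>S. \<not> sbt_gt1 n ?w R S"
    using assms by (auto simp: sbt_minimal_iff)
  have anti: "fst (?q l) \<le> fst (?q k)" if "1 \<le> k" "k \<le> l" "l \<le> n choose 2" for k l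
    using that(2,3)
  proof (induction l rule: dec_induct)
    case (step l)
    then have "fst (?q (l + 1)) \<le> fst (?q l)"
      using rows_antimono_if_minimal[OF R min, of l] that by auto
    then show ?case using step by auto
  qed simp
  have higher: "R x < R y" if "x \<in> staircase n" "y \<in> staircase n" "fst x > fst y" for x y
    using anti[of "R y" "R x"] cell_of_entry[OF R that(1)] cell_of_entry[OF R that(2)]
      SBT_longest_perm_range[OF R that(1)] SBT_longest_perm_range[OF R that(2)] that(3)
    by (cases "R x < R y") auto
  have before: "R x < R y" if x: "x \<in> staircase n" and y: "y \<in> staircase n" and xy: "reads_before x y" for x y
  proof (cases "fst x > fst y")
    case True
    then show ?thesis using higher x y by blast
  next
    case False
    then have row: "fst x = fst y" "snd x < snd y" using xy by (auto simp: reads_before_def)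
    define a b c where "a = fst x" and "b = n + 1 - snd y" and "c = n + 1 - snd x"
    have abc: "1 \<le> a" "a < b" "b < c" "c \<le> n"
      and eq: "x = (a, n + 1 - c)" "y = (a, n + 1 - b)"
      using x y row unfolding a_def b_def c_def by (auto simp: staircase_def prod_eq_iff)
    \<comment> \<open>The cell of \<open>(b, c)\<close> lies above \<open>x\<close> and therefore
      has a smaller entry; betweenness then puts the entry of \<open>y\<close> on the other side of
      that of \<open>x\<close>.\<close>
    have "R (b, n + 1 - c) < R x"
      by (rule higher[OF _ x]) (use abc eq in \<open>auto simp: staircase_def\<close>)
    then show ?thesis
      using betweennessD[OF SBT_longest_permD(4)[OF R] abc] unfolding eq by linarith
  qed
  have iff: "R y \<le> R x \<longleftrightarrow> y = x \<or> reads_before y x" if "x \<in> staircase n" "y \<in> staircase n" for x y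
    using before[OF that] before[OF that(2,1)] reads_before_total[of x y] by fastforce
  show ?thesis
  proof
    fix x
    show "R x = row_reading n x"
    proof (cases "x \<in> staircase n")
      case True
      \<comment> \<open>An entry of a bijective filling equals the number of cells whose entry does
        not exceed it.\<close>
      have "bij_betw R {y \<in> staircase n. R y \<le> R x} {1..R x}"
      proof (rule bij_betw_subset[OF SBT_longest_permD(2)[OF R]])
        have "k \<in> R ` {y \<in> staircase n. R y \<le> R x}" if "1 \<le> k" "k \<le> R x" for k
          using entry_cell_of[OF R, of k] that SBT_longest_perm_range[OF R True]
          by (intro image_eqI[of _ _ "?q k"]) auto
        then show "R ` {y \<in> staircase n. R y \<le> R x} = {1..R x}"
          using SBT_longest_perm_range(1)[OF R] by auto
      qed auto
      then have "R x = card {y \<in> staircase n. R y \<le> R x}"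
        by (simp add: bij_betw_same_card)
      also have "{y \<in> staircase n. R y \<le> R x} = {y \<in> staircase n. y = x \<or> reads_before y x}"
        using iff[OF True] by blast
      finally show ?thesis using True by (simp add: row_reading_def)
    next
      case False
      then show ?thesis
        using extensional_arb[OF SBT_longest_permD(1)[OF R]] by (simp add: row_reading_def)
    qed
  qed
qed

section \<open>Counting the pairs of cells\<close>

text \<open>Here \<open>s\<close> and \<open>t\<close> are the lengths of the higher and the lower
  row. The column in the shorter row is free, and the other column only has to avoid it.\<close>

lemma card_cell_pairs_eq_sum:
  "card (cell_pairs n) = (\<Sum>s<n. \<Sum>t \<in> {s<..<n}. s * (t - 1))"
proof -
  let ?X = "Sigma {..<n} (\<lambda>s. Sigma {s<..<n} (\<lambda>t. Sigma {1..s} (\<lambda>c. {1..t} - {c})))"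
  have "card (cell_pairs n) = card ?X"
    by (rule bij_betw_same_card[of "\<lambda>((r, c), (r', c')). (n - r, n - r', c, c')"],
        rule bij_betw_byWitness[of _ "\<lambda>(s, t, c, c'). ((n - s, c), (n - t, c'))"])
       (auto simp: cell_pairs_def staircase_def)
  also have "\<dots> = (\<Sum>s<n. \<Sum>t \<in> {s<..<n}. \<Sum>c \<in> {1..s}. card ({1..t} - {c}))"
    by (simp add: card_SigmaI del: card_Diff_insert)
  also have "\<dots> = (\<Sum>s<n. \<Sum>t \<in> {s<..<n}. s * (t - 1))"
    by (intro sum.cong refl) (simp add: card_Diff_singleton)
  finally show ?thesis .
qed

lemma card_cell_pairs:
  "real (card (cell_pairs n)) = (real n - 2) * (real n - 1) * real n * (3 * real n - 5) / 24"
proof (induction n)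
  case 0
  then show ?case by (simp add: card_cell_pairs_eq_sum)
next
  case (Suc n)
  \<comment> \<open>The larger staircase gains one row, of length \<open>n\<close>, which pairs with
    every shorter one.\<close>
  have "(\<Sum>t \<in> {s<..<Suc n}. s * (t - 1)) = (\<Sum>t \<in> {s<..<n}. s * (t - 1)) + s * (n - 1)"
    if "s < n" for s
  proof -
    have "{s<..<Suc n} = insert n {s<..<n}" using that by auto
    then show ?thesis by simp
  qed
  then have "card (cell_pairs (Suc n)) = card (cell_pairs n) + (\<Sum>s<n. s * (n - 1))"
    by (simp add: card_cell_pairs_eq_sum sum.distrib)
  also have "(\<Sum>s<n. s * (n - 1)) = (\<Sum>s<n. s) * (n - 1)"
    by (simp add: sum_distrib_right)
  finally have "real (card (cell_pairs (Suc n))) = real (card (cell_pairs n)) + (\<Sum>s<n. real s) * real (n - 1)"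
    by simp
  moreover have "(\<Sum>s<n. real s) * real (n - 1) = real n * (real n - 1) ^ 2 / 2"
  proof -
    have "(\<Sum>s<n. real s) = real n * (real n - 1) / 2"
      by (induction n) (auto simp: field_simps)
    \<comment> \<open>The case split handles the truncated \<open>n - 1\<close> at
      \<open>n = 0\<close>, where both sides vanish.\<close>
    then show ?thesis by (cases n) (auto simp: power2_eq_square)
  qed
  ultimately show ?case
    unfolding Suc.IH by (simp add: field_simps power2_eq_square)
qed

theorem theorem4p5:
  fixes n :: nat
  assumes "n \<ge> 2"
  shows "(\<forall>R \<in> SBT n (longest_perm n). psi n R \<in> SBT n (longest_perm n) \<and> psi n (psi n R) = R) \<and>
    monotone_on (SBT n (longest_perm n))
      (sbt_le n (longest_perm n)) (\<lambda>R S. sbt_le n (longest_perm n) S R) (psi n) \<and>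
    (\<exists>B. sbt_minimal n (longest_perm n) B \<and>
      (\<forall>C. sbt_minimal n (longest_perm n) C \<longrightarrow> C = B) \<and>
      real (sbt_inv n (longest_perm n) B) =
        (real n - 2) * (real n - 1) * real n * (3 * real n - 5) / 24)"
proof (intro conjI)
  show "\<forall>R \<in> SBT n (longest_perm n). psi n R \<in> SBT n (longest_perm n) \<and> psi n (psi n R) = R"
    using psi_in_SBT psi_psi by blast
  show "monotone_on (SBT n (longest_perm n))
      (sbt_le n (longest_perm n)) (\<lambda>R S. sbt_le n (longest_perm n) S R) (psi n)"
    by (rule monotone_onI) (auto simp: sbt_le_def psi_in_SBT intro: sbt_less_psi)
  show "\<exists>B. sbt_minimal n (longest_perm n) B \<and>
      (\<forall>C. sbt_minimal n (longest_perm n) C \<longrightarrow> C = B) \<and>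
      real (sbt_inv n (longest_perm n) B) =
        (real n - 2) * (real n - 1) * real n * (3 * real n - 5) / 24"
    using sbt_minimal_row_reading sbt_minimal_unique card_cell_pairs[of n]
    by (intro exI[of _ "row_reading n"]) (simp add: sbt_inv_row_reading)
qed

end
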